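(* Let $T>0$, $I=[0,T]$, $q\in(0,1]$, let $\mathcal{H}_1,\mathcal{H}_2$ be real Hilbert spaces, let $\Omega\subset\mathcal{H}_2$ be nonempty, closed and convex, let $K:\Omega\to 2^{\Omega}$ be a set-valued mapping with nonempty closed convex values, let $f:I\times\mathcal{H}_1\to\mathcal{H}_1$, $g:I\times\mathcal{H}_1\times\mathcal{H}_2\to\mathcal{H}_1$, $G:I\times\mathcal{H}_1\times\Omega\to\mathcal{H}_2$, $\psi:C(I,\mathcal{H}_1)\to\mathcal{H}_1$, and $x_0\in\mathcal{H}_1$. Assume: (1) there are constants $l_G,\eta_G>0$ such that $\|G(s_2,x_2,u_2)-G(s_1,x_1,u_1)\|\le l_G(|s_2-s_1|+\|x_2-x_1\|+\|u_2-u_1\|)$ for all $s_1,s_2\in I$, $x_1,x_2\in\mathcal{H}_1$, $u_1,u_2\in\Omega$, and, for all $s\in I$, $x\in\mathcal{H}_1$, $u\in\Omega$ and $u_1,u_2\in K(u)$, $\langle G(s,x,u_2),u_1-u_2\rangle\ge 0$ implies $\langle G(s,x,u_1),u_1-u_2\rangle\ge\eta_G\|u_1-u_2\|^2$; (2) there is $l_K\ge 0$ such that $\|P_{K(u_2)}[\varpi]-P_{K(u_1)}[\varpi]\|\le l_K\|u_2-u_1\|$ for all $u_1,u_2\in\Omega$, $\varpi\in\mathcal{H}_2$; (3) $g$ is continuous and there is $l_g>0$ with $\|g(s,x_2,u_2)-g(s,x_1,u_1)\|\le l_g(\|x_2-x_1\|+\|u_2-u_1\|)$ for all $s\in I$,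 $x_1,x_2\in\mathcal{H}_1$, $u_1,u_2\in\mathcal{H}_2$; (4) $f$ is continuous and there is $l_f>0$ with $\|f(s,x_2)-f(s,x_1)\|\le l_f\|x_2-x_1\|$ for all $s\in I$, $x_1,x_2\in\mathcal{H}_1$; (5) $\psi$ is continuous and there is $0<l_\psi<1$ with $\|\psi(y_2)-\psi(y_1)\|\le l_\psi\|y_2-y_1\|_{\mathcal{B}}$ for all $y_1,y_2\in C(I,\mathcal{H}_1)$; (6) $2\dfrac{l_K^2}{\eta_G^2}\left(l_G\sqrt{4l_G^2+2\eta_G^2}+2l_G^2+\eta_G^2\right)<1$. If $\varphi\in C(I,R_+)$ is a nondecreasing function, then the nonlocal fractional differential quasi-variational inequality (NFDQVI) $$\begin{cases}{}^{C}_{0}\mathrm{D}_s^{q}x(s)=f(s,x(s))+g(s,x(s),u(s)), & s\in I,\\ u(s)\in\mathrm{SOL}(K(\cdot),G(s,x(s),\cdot)), & s\in I,\\ x(0)=x_0+\psi(x)\end{cases}$$ is generalized Mittag-Leffler-Hyers-Ulam-Rassias stable with respect to $\varphi\mathrm{E}_q$.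
   Context: $R_+=[0,\infty)$. $P_C$ is the metric projection onto a nonempty closed convex set $C$. $C(I,Y)$ is the space of continuous functions $I\to Y$; $C(I,\mathcal{H}_1)$ is equipped with the Bielecki norm $\|x\|_{\mathcal{B}}=\max_{s\in I}e^{-\gamma s}\|x(s)\|$, where $\gamma>0$ is a given constant. ${}^{C}_{0}\mathrm{D}_s^{q}$ is the Caputo fractional derivative of order $q$. $\mathrm{E}_q(t)=\sum_{n=0}^\infty \frac{t^n}{\Gamma(nq+1)}$ is the Mittag-Leffler function. $\mathrm{SOL}(K(\cdot),G(s,z,\cdot))$ is the set of all $w\in\Omega$ with $w\in K(w)$ and $\langle G(s,z,w),v-w\rangle\ge 0$ for all $v\in K(w)$. By definition, $(x,u)\in C(I,\mathcal{H}_1)\times C(I,\Omega)$ is a solution of the NFDQVI if, for all $s\in I$, $x(s)=x_0+\psi(x)+\frac{1}{\Gamma(q)}\int_0^s(s-\zeta)^{q-1}[f(\zeta,x(\zeta))+g(\zeta,x(\zeta),u(\zeta))]\,d\zeta$ and $u(s)\in\mathrm{SOL}(K(\cdot),G(s,x(s),\cdot))$ (Bochner integrals). Generalized Mittag-Leffler-Hyers-Ulam-Rassias stability with respect to $\varphi\mathrm{E}_q$ means: there exists a real number $c_\varphi>0$ such that for each solution $(z,\upsilon)\in C(I,\mathcal{H}_1)\times C(I,\Omega)$ of the system $$\begin{cases}\left\|{}^{C}_{0}\mathrm{D}_s^{q}z(s)-f(s,z(s))-g(s,z(s),\upsilon(s))\right\|\le\varphi(s), & s\in I,\\ \upsilon(s)\in\mathrm{SOL}(K(\cdot),G(s,z(s),\cdot)),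 & s\in I,\\ z(0)=x(0),\end{cases}$$ where $x$ is the trajectory (first component) of a solution $(x,u)$ of the NFDQVI, there exists such a solution $(x,u)$ of the NFDQVI with $\|z(s)-x(s)\|\le c_\varphi\,\varphi(s)\,\mathrm{E}_q(s)$ for all $s\in I$. A pair $(z,\upsilon)$ solves this inequality system iff there is $h\in C(I,\mathcal{H}_1)$ with $\|h(s)\|\le\varphi(s)$ for all $s\in I$, such that for all $s\in I$: $z(s)=z(0)+\frac{1}{\Gamma(q)}\int_0^s(s-\zeta)^{q-1}[f(\zeta,z(\zeta))+g(\zeta,z(\zeta),\upsilon(\zeta))+h(\zeta)]\,d\zeta$, $\upsilon(s)\in\mathrm{SOL}(K(\cdot),G(s,z(s),\cdot))$, and $z(0)=x(0)$. *)

theory Defs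
  imports "HOL-Analysis.Analysis"
begin

text \<open>
  Real Hilbert spaces are types of sort \<open>{real_inner, complete_space}\<close>. They are not assumed
  separable, and the library constants \<open>has_bochner_integral\<close> (second countable range) and
  \<open>closest_point\<close> (Heine-Borel range) are therefore unavailable; the two definitions below repeat
  the usual notions without these restrictions.

  Elements of \<open>C(I, Y)\<close> with \<open>I = [0, T]\<close> are represented by functions on the whole real line
  that are continuous on \<open>{0..T}\<close>; their values outside \<open>{0..T}\<close> are irrelevant.
\<close>

definition bochner_has_integral ::
    "'m measure \<Rightarrow> ('m \<Rightarrow> 'a::real_normed_vector) \<Rightarrow> 'a \<Rightarrow> bool" where
  "bochner_has_integral M F J \<longleftrightarrow>
     F \<in> borel_measurable M \<and>
     (\<exists>S. (\<forall>i::nat. Bochner_Integration.simple_bochner_integrable M (S i)) \<and>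
          (\<lambda>i. \<integral>\<^sup>+ t. ennreal (norm (F t - S i t)) \<partial>M) \<longlonglongrightarrow> 0 \<and>
          (\<lambda>i. Bochner_Integration.simple_bochner_integral M (S i)) \<longlonglongrightarrow> J)"

lemma bochner_has_integral_eq_has_bochner_integral:
  fixes F :: "'m \<Rightarrow> 'a::{real_normed_vector, second_countable_topology}"
  shows "bochner_has_integral M F J \<longleftrightarrow> has_bochner_integral M F J"
  unfolding bochner_has_integral_def has_bochner_integral.simps by blast

definition metric_projection :: "'a::metric_space set \<Rightarrow> 'a \<Rightarrow> 'a" where
  "metric_projection C w = (THE p. p \<in> C \<and> (\<forall>v\<in>C. dist w p \<le> dist w v))"

text \<open>The maximum defining the Bielecki norm is a supremum attained on the compact interval
  whenever \<open>x\<close> is continuous on it.\<close>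

definition bielecki_norm :: "real \<Rightarrow> real \<Rightarrow> (real \<Rightarrow> 'a::real_normed_vector) \<Rightarrow> real" where
  "bielecki_norm \<gamma> T x = (SUP s\<in>{0..T}. exp (- \<gamma> * s) * norm (x s))"

definition bielecki_continuous ::
    "real \<Rightarrow> real \<Rightarrow> ((real \<Rightarrow> 'a::real_normed_vector) \<Rightarrow> 'b::real_normed_vector) \<Rightarrow> bool" where
  "bielecki_continuous \<gamma> T \<psi> \<longleftrightarrow>
     (\<forall>y. continuous_on {0..T} y \<longrightarrow>
       (\<forall>\<epsilon>>0. \<exists>\<delta>>0. \<forall>y'. continuous_on {0..T} y' \<longrightarrow>
          bielecki_norm \<gamma> T (\<lambda>s. y' s - y s) < \<delta> \<longrightarrow> norm (\<psi> y' - \<psi> y) < \<epsilon>))"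

definition mittag_leffler :: "real \<Rightarrow> real \<Rightarrow> real" where
  "mittag_leffler q t = (\<Sum>n. t ^ n / Gamma (real n * q + 1))"

definition has_fractional_integral ::
    "real \<Rightarrow> (real \<Rightarrow> 'a::real_normed_vector) \<Rightarrow> real \<Rightarrow> 'a \<Rightarrow> bool" where
  "has_fractional_integral q F s J \<longleftrightarrow>
     (\<exists>J0. bochner_has_integral (lebesgue_on {0..s}) (\<lambda>\<zeta>. (s - \<zeta>) powr (q - 1) *\<^sub>R F \<zeta>) J0 \<and>
           J = (1 / Gamma q) *\<^sub>R J0)"

definition SOL :: "'b set \<Rightarrow> ('b \<Rightarrow> 'b set) \<Rightarrow> ('b \<Rightarrow> 'b::real_inner) \<Rightarrow> 'b set" where
  "SOL \<Omega> K F = {w \<in> \<Omega>. w \<in> K w \<and> (\<forall>v\<in>K w. inner (F w) (v - w) \<ge> 0)}"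

definition nfdqvi_solution ::
    "real \<Rightarrow> real \<Rightarrow> 'b set \<Rightarrow> ('b \<Rightarrow> 'b set)
     \<Rightarrow> (real \<Rightarrow> 'a \<Rightarrow> 'a) \<Rightarrow> (real \<Rightarrow> 'a \<Rightarrow> 'b \<Rightarrow> 'a) \<Rightarrow> (real \<Rightarrow> 'a \<Rightarrow> 'b \<Rightarrow> 'b)
     \<Rightarrow> ((real \<Rightarrow> 'a) \<Rightarrow> 'a) \<Rightarrow> 'a
     \<Rightarrow> (real \<Rightarrow> 'a::real_normed_vector) \<Rightarrow> (real \<Rightarrow> 'b::real_inner) \<Rightarrow> bool" where
  "nfdqvi_solution T q \<Omega> K f g G \<psi> x0 x u \<longleftrightarrow>
     continuous_on {0..T} x \<and>
     continuous_on {0..T} u \<and> (\<forall>s\<in>{0..T}. u s \<in> \<Omega>) \<and>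
     (\<forall>s\<in>{0..T}.
        (\<exists>J. has_fractional_integral q (\<lambda>\<zeta>. f \<zeta> (x \<zeta>) + g \<zeta> (x \<zeta>) (u \<zeta>)) s J \<and>
             x s = x0 + \<psi> x + J) \<and>
        u s \<in> SOL \<Omega> K (G s (x s)))"

text \<open>
  Solutions of the perturbed system: the inequality
  \<open>\<parallel>D\<^sup>q z(s) - f(s, z(s)) - g(s, z(s), \<upsilon>(s))\<parallel> \<le> \<phi>(s)\<close> for the Caputo derivative \<open>D\<^sup>q\<close> is
  understood in integrated form, exactly as the equation itself is in \<open>nfdqvi_solution\<close>: the
  residual is a continuous function \<open>h\<close> dominated by \<open>\<phi>\<close>, so \<open>D\<^sup>q z = f + g + h\<close>. The argument
  \<open>x\<close> is the trajectory that prescribes the initial value of \<open>z\<close>.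
\<close>

definition perturbed_solution ::
    "real \<Rightarrow> real \<Rightarrow> 'b set \<Rightarrow> ('b \<Rightarrow> 'b set)
     \<Rightarrow> (real \<Rightarrow> 'a \<Rightarrow> 'a) \<Rightarrow> (real \<Rightarrow> 'a \<Rightarrow> 'b \<Rightarrow> 'a) \<Rightarrow> (real \<Rightarrow> 'a \<Rightarrow> 'b \<Rightarrow> 'b)
     \<Rightarrow> (real \<Rightarrow> real) \<Rightarrow> (real \<Rightarrow> 'a)
     \<Rightarrow> (real \<Rightarrow> 'a::real_normed_vector) \<Rightarrow> (real \<Rightarrow> 'b::real_inner) \<Rightarrow> bool" where
  "perturbed_solution T q \<Omega> K f g G \<phi> x z \<upsilon> \<longleftrightarrow>
     continuous_on {0..T} z \<and>
     continuous_on {0..T} \<upsilon> \<and> (\<forall>s\<in>{0..T}. \<upsilon> s \<in> \<Omega>) \<and>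
     (\<exists>h. continuous_on {0..T} h \<and> (\<forall>s\<in>{0..T}. norm (h s) \<le> \<phi> s) \<and>
        (\<forall>s\<in>{0..T}. \<exists>J.
           has_fractional_integral q (\<lambda>\<zeta>. f \<zeta> (z \<zeta>) + g \<zeta> (z \<zeta>) (\<upsilon> \<zeta>) + h \<zeta>) s J \<and>
           z s = z 0 + J)) \<and>
     (\<forall>s\<in>{0..T}. \<upsilon> s \<in> SOL \<Omega> K (G s (z s))) \<and>
     z 0 = x 0"

definition generalized_ML_HUR_stable ::
    "real \<Rightarrow> real \<Rightarrow> 'b set \<Rightarrow> ('b \<Rightarrow> 'b set)
     \<Rightarrow> (real \<Rightarrow> 'a \<Rightarrow> 'a) \<Rightarrow> (real \<Rightarrow> 'a \<Rightarrow> 'b \<Rightarrow> 'a) \<Rightarrow> (real \<Rightarrow> 'a::real_normed_vector \<Rightarrow> 'b \<Rightarrow> 'b::real_inner)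
     \<Rightarrow> ((real \<Rightarrow> 'a) \<Rightarrow> 'a) \<Rightarrow> 'a \<Rightarrow> (real \<Rightarrow> real) \<Rightarrow> bool" where
  "generalized_ML_HUR_stable T q \<Omega> K f g G \<psi> x0 \<phi> \<longleftrightarrow>
     (\<exists>c>0. \<forall>z \<upsilon>.
        (\<exists>x u. nfdqvi_solution T q \<Omega> K f g G \<psi> x0 x u \<and>
               perturbed_solution T q \<Omega> K f g G \<phi> x z \<upsilon>) \<longrightarrow>
        (\<exists>x u. nfdqvi_solution T q \<Omega> K f g G \<psi> x0 x u \<and>
               perturbed_solution T q \<Omega> K f g G \<phi> x z \<upsilon> \<and>
               (\<forall>s\<in>{0..T}. norm (z s - x s) \<le> c * \<phi> s * mittag_leffler q s)))"

end

theory Submission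
  imports Defs
begin

text \<open>
  The pair \<open>(x, u)\<close> that prescribes the initial value of \<open>z\<close> is itself the solution close to
  \<open>(z, \<upsilon>)\<close>. At \<open>s = 0\<close> the fractional integral vanishes, so \<open>x 0 = x0 + \<psi> x\<close>; as \<open>z 0 = x 0\<close>, the
  nonlocal terms cancel and \<open>z - x\<close> is the fractional integral of order \<open>q\<close> of the difference of
  the two right-hand sides.

  That difference is bounded by \<open>M \<parallel>z - x\<parallel> + \<phi>\<close> for a constant \<open>M\<close>, provided that \<open>\<parallel>\<upsilon> - u\<parallel>\<close> is
  bounded by a multiple of \<open>\<parallel>z - x\<parallel>\<close>: solutions of the quasi-variational inequality depend in a
  Lipschitz way on the state. This is the content of \<open>SOL_lipschitz\<close>, proved by one projected
  gradient step; \<open>projection_constant_small\<close> extracts the contraction factor it needs from the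
  smallness condition on \<open>l\<^sub>K\<close>. Projections onto closed convex sets in Hilbert spaces of
  arbitrary dimension are constructed first.

  What remains is a Gronwall argument. In the weighted norm \<open>sup exp (- \<mu> t) \<parallel>y t\<parallel>\<close> fractional
  integration has norm at most \<open>1 / \<mu>\<^sup>q\<close> (\<open>fractional_kernel_exp_le\<close>). Taking \<open>\<mu>\<^sup>q = 2 M\<close>
  and using that \<open>\<phi>\<close> is nondecreasing, \<open>fractional_gronwall\<close> gives
  \<open>\<parallel>z s - x s\<parallel> \<le> exp (\<mu> T) / M * \<phi> s\<close>. The Mittag-Leffler factor may be appended because it is at
  least its first term \<open>1\<close>; this requires convergence of the series, which follows from a lower
  bound for the Gamma function.
\<close>

section \<open>Metric projections in Hilbert spaces\<close>

text \<open>In an infinite-dimensional space a bounded minimizing sequence need not have a convergent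
  subsequence, but by the parallelogram law and convexity (the midpoint of two points of \<open>C\<close> is
  no closer to \<open>w\<close> than the distance \<open>d\<close>) every minimizing sequence is Cauchy.\<close>

lemma nearest_point_exists:
  fixes C :: "'b::{real_inner, complete_space} set"
  assumes "C \<noteq> {}" "closed C" "convex C"
  shows "\<exists>p\<in>C. \<forall>v\<in>C. dist w p \<le> dist w v"
proof -
  define d where "d = (INF v\<in>C. dist w v)"
  have bdd: "bdd_below ((\<lambda>v. dist w v) ` C)"
    by (rule bdd_belowI[of _ 0]) auto
  have d_le: "d \<le> dist w v" if "v \<in> C" for v
    unfolding d_def by (rule cINF_lower[OF bdd that])
  have d0: "d \<ge> 0"
    unfolding d_def by (rule cINF_greatest) (use assms in auto)
  have "\<exists>v\<in>C. (dist w v)\<^sup>2 < d\<^sup>2 + 1 / real (Suc n)" for n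
  proof -
    have "d < sqrt (d\<^sup>2 + 1 / real (Suc n))"
      by (rule real_less_rsqrt) simp
    then obtain v where v: "v \<in> C" "dist w v < sqrt (d\<^sup>2 + 1 / real (Suc n))"
      unfolding d_def using cINF_less_iff[OF assms(1) bdd] by blast
    then have "(dist w v)\<^sup>2 < (sqrt (d\<^sup>2 + 1 / real (Suc n)))\<^sup>2"
      by (intro power_strict_mono) auto
    with v show ?thesis by (auto simp: add_nonneg_nonneg)
  qed
  then obtain y where yC: "\<And>n. y n \<in> C"
    and y: "\<And>n. (dist w (y n))\<^sup>2 < d\<^sup>2 + 1 / real (Suc n)"
    by metis
  have parallelogram: "(dist (y m) (y n))\<^sup>2 \<le> 2 / real (Suc m) + 2 / real (Suc n)" for m n
  proof -
    define c where "c = (1/2) *\<^sub>R y m + (1/2) *\<^sub>R y n"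
    have "c \<in> C"
      unfolding c_def using assms(3) yC by (intro convexD) auto
    then have "d\<^sup>2 \<le> (dist w c)\<^sup>2"
      using d_le d0 by (intro power_mono) auto
    moreover have "(dist (y m) (y n))\<^sup>2
        = 2 * (dist w (y m))\<^sup>2 + 2 * (dist w (y n))\<^sup>2 - 4 * (dist w c)\<^sup>2"
      unfolding c_def dist_norm power2_norm_eq_inner
      by (simp add: inner_diff_left inner_diff_right inner_add_left inner_add_right
          inner_commute algebra_simps)
    ultimately show ?thesis using y[of m] y[of n] by (simp add: algebra_simps)
  qed
  have "Cauchy y"
  proof (rule metric_CauchyI)
    fix e :: real assume e: "e > 0"
    obtain N where N: "4 / e\<^sup>2 < real N" using reals_Archimedean2 by blast
    then have Npos: "real N > 0" using e by (smt (verit) divide_nonneg_nonneg zero_le_power2)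
    have "dist (y m) (y n) < e" if "m \<ge> N" "n \<ge> N" for m n
    proof -
      have "2 / real (Suc m) \<le> 2 / real N" "2 / real (Suc n) \<le> 2 / real N"
        using that Npos by (auto intro!: divide_left_mono)
      then have "(dist (y m) (y n))\<^sup>2 \<le> 4 / real N" using parallelogram[of m n] by simp
      also have "\<dots> < e\<^sup>2" using N Npos e by (simp add: field_simps)
      finally show ?thesis using e by (simp add: power_less_imp_less_base)
    qed
    then show "\<exists>M. \<forall>m\<ge>M. \<forall>n\<ge>M. dist (y m) (y n) < e" by blast
  qed
  then obtain p where p: "y \<longlonglongrightarrow> p"
    using Cauchy_convergent convergent_def by blast
  have "p \<in> C" using closed_sequentially[OF assms(2)] yC p by blast
  moreover have "(dist w p)\<^sup>2 \<le> d\<^sup>2"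
  proof (rule LIMSEQ_le)
    show "(\<lambda>n. (dist w (y n))\<^sup>2) \<longlonglongrightarrow> (dist w p)\<^sup>2" by (intro tendsto_intros p)
    show "(\<lambda>n. d\<^sup>2 + 1 / real (Suc n)) \<longlonglongrightarrow> d\<^sup>2"
      using tendsto_add[OF tendsto_const LIMSEQ_inverse_real_of_nat, of "d\<^sup>2"]
      by (simp add: inverse_eq_divide)
    show "\<exists>N. \<forall>n\<ge>N. (dist w (y n))\<^sup>2 \<le> d\<^sup>2 + 1 / real (Suc n)"
      using y less_imp_le by blast
  qed
  then have "dist w p \<le> d" using d0 by (rule power2_le_imp_le)
  ultimately show ?thesis using d_le order_trans by blast
qed

text \<open>Moving from the nearest point \<open>p\<close> a fraction \<open>t\<close> of the way to \<open>v\<close> changes the squared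
  distance to \<open>w\<close> by \<open>t\<^sup>2 \<parallel>v - p\<parallel>\<^sup>2 - 2 t \<langle>w - p, v - p\<rangle>\<close>; for small \<open>t\<close> the linear term decides.\<close>

lemma nearest_point_variational:
  fixes C :: "'b::real_inner set"
  assumes "convex C" "p \<in> C" "\<forall>v\<in>C. dist w p \<le> dist w v" "v \<in> C"
  shows "inner (w - p) (v - p) \<le> 0"
proof (rule ccontr)
  assume "\<not> ?thesis"
  then have pos: "inner (w - p) (v - p) > 0" by simp
  define n where "n = (norm (v - p))\<^sup>2"
  have n: "n > 0" using pos unfolding n_def by auto
  define t where "t = min 1 (inner (w - p) (v - p) / n)"
  have t: "0 < t" "t \<le> 1" "t * n \<le> inner (w - p) (v - p)"
    using pos n by (auto simp: t_def field_simps min_def)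
  have "p + t *\<^sub>R (v - p) = (1 - t) *\<^sub>R p + t *\<^sub>R v" by (simp add: algebra_simps)
  also have "\<dots> \<in> C" using assms t by (intro convexD) auto
  finally have "(norm (w - p))\<^sup>2 \<le> (norm (w - (p + t *\<^sub>R (v - p))))\<^sup>2"
    using assms(3) by (intro power_mono) (auto simp: dist_norm)
  also have "\<dots> = (norm (w - p))\<^sup>2 - 2 * t * inner (w - p) (v - p) + t * (t * n)"
    unfolding n_def power2_norm_eq_inner
    by (simp add: inner_diff_left inner_diff_right inner_add_left inner_add_right
        inner_commute algebra_simps)
  also have "\<dots> \<le> (norm (w - p))\<^sup>2 - 2 * t * inner (w - p) (v - p) + t * inner (w - p) (v - p)"
    using t by (intro add_left_mono mult_left_mono) auto
  finally have "t * inner (w - p) (v - p) \<le> 0" by simp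
  then show False using t pos by (simp add: mult_le_0_iff)
qed

lemma metric_projection_eqI:
  fixes C :: "'b::real_inner set"
  assumes "p \<in> C" "\<And>v. v \<in> C \<Longrightarrow> inner (w - p) (v - p) \<le> 0"
  shows "metric_projection C w = p"
proof -
  have expand: "(dist w v)\<^sup>2 = (dist w p)\<^sup>2 + (norm (v - p))\<^sup>2 - 2 * inner (w - p) (v - p)" for v
    unfolding dist_norm power2_norm_eq_inner
    by (simp add: inner_diff_left inner_diff_right inner_commute algebra_simps)
  show ?thesis unfolding metric_projection_def
  proof (rule the_equality)
    have "dist w p \<le> dist w v" if "v \<in> C" for v
    proof (rule power2_le_imp_le)
      show "(dist w p)\<^sup>2 \<le> (dist w v)\<^sup>2"
        using expand[of v] assms(2)[OF that] zero_le_power2[of "norm (v - p)"] by linarith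
    qed simp
    then show "p \<in> C \<and> (\<forall>v\<in>C. dist w p \<le> dist w v)" using assms(1) by blast
  next
    fix p' assume p': "p' \<in> C \<and> (\<forall>v\<in>C. dist w p' \<le> dist w v)"
    then have "(dist w p')\<^sup>2 \<le> (dist w p)\<^sup>2" using assms(1) by (intro power_mono) auto
    moreover have "inner (w - p) (p' - p) \<le> 0" using assms(2) p' by blast
    ultimately have "(norm (p' - p))\<^sup>2 \<le> 0" using expand[of p'] by linarith
    then show "p' = p" by simp
  qed
qed

lemma metric_projection_variational:
  fixes C :: "'b::{real_inner, complete_space} set"
  assumes "C \<noteq> {}" "closed C" "convex C"
  shows metric_projection_in: "metric_projection C w \<in> C"
    and metric_projection_inner_le:
      "v \<in> C \<Longrightarrow> inner (w - metric_projection C w) (v - metric_projection C w) \<le> 0"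
proof -
  obtain p where p: "p \<in> C" "\<forall>v\<in>C. dist w p \<le> dist w v"
    using nearest_point_exists[OF assms] by blast
  note var = nearest_point_variational[OF assms(3) p]
  have "metric_projection C w = p" using p(1) var by (rule metric_projection_eqI)
  then show "metric_projection C w \<in> C"
    "v \<in> C \<Longrightarrow> inner (w - metric_projection C w) (v - metric_projection C w) \<le> 0"
    using p var by auto
qed

section \<open>Lipschitz dependence of solutions of quasi-variational inequalities\<close>

lemma SOL_fixed_point_projection:
  assumes "u \<in> SOL \<Omega> K F" "\<rho> \<ge> 0"
  shows "metric_projection (K u) (u - \<rho> *\<^sub>R F u) = u"
proof (rule metric_projection_eqI)
  show "u \<in> K u" using assms by (simp add: SOL_def)
  fix v assume "v \<in> K u"
  then show "inner (u - \<rho> *\<^sub>R F u - u) (v - u) \<le> 0"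
    using assms by (auto simp: SOL_def intro!: mult_nonneg_nonneg)
qed

text \<open>Strong pseudomonotonicity compares points of one and the same set \<open>K u2\<close>, whereas \<open>u1\<close> lies
  in \<open>K u1\<close>. Therefore \<open>u1\<close> is first replaced by the projection \<open>p\<close> onto \<open>K u2\<close> of a gradient step
  \<open>u1 - \<rho> F1 u1\<close>: since \<open>u1\<close> is the projection of the same point onto \<open>K u1\<close>, this costs at most
  \<open>l\<^sub>K \<parallel>u1 - u2\<parallel>\<close>. The pair \<open>p, u2\<close> then yields
  \<open>\<eta> \<parallel>p - u2\<parallel> \<le> l\<^sub>G (d + \<parallel>p - u1\<parallel>) + \<parallel>p - u1\<parallel> / \<rho>\<close>. A long step makes the last term small;
  \<open>\<rho> = 4 / \<eta>\<close> is long enough for the contraction factor below to be less than one under the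
  hypothesis of \<open>projection_constant_small\<close>.\<close>

lemma SOL_lipschitz:
  fixes \<Omega> :: "'b::{real_inner, complete_space} set" and l\<^sub>G l\<^sub>K \<eta> d :: real
  assumes K: "\<And>u. u \<in> \<Omega> \<Longrightarrow> K u \<subseteq> \<Omega> \<and> K u \<noteq> {} \<and> closed (K u) \<and> convex (K u)"
    and pos: "l\<^sub>G \<ge> 0" "\<eta> > 0"
    and lip: "\<And>v w. v \<in> \<Omega> \<Longrightarrow> w \<in> \<Omega> \<Longrightarrow> norm (F2 w - F1 v) \<le> l\<^sub>G * (d + norm (w - v))"
    and mono: "\<And>u v w. u \<in> \<Omega> \<Longrightarrow> v \<in> K u \<Longrightarrow> w \<in> K u \<Longrightarrow> inner (F2 w) (v - w) \<ge> 0 \<Longrightarrow>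
                  inner (F2 v) (v - w) \<ge> \<eta> * (norm (v - w))\<^sup>2"
    and proj: "\<And>u v w. u \<in> \<Omega> \<Longrightarrow> v \<in> \<Omega> \<Longrightarrow>
                  norm (metric_projection (K v) w - metric_projection (K u) w) \<le> l\<^sub>K * norm (v - u)"
    and u1: "u1 \<in> SOL \<Omega> K F1" and u2: "u2 \<in> SOL \<Omega> K F2"
  shows "(1 - l\<^sub>K * (5/4 + l\<^sub>G / \<eta>)) * norm (u2 - u1) \<le> l\<^sub>G / \<eta> * d"
proof -
  define \<rho> where "\<rho> = 4 / \<eta>"
  have \<rho>: "\<rho> > 0" using pos by (simp add: \<rho>_def)
  have in\<Omega>: "u1 \<in> \<Omega>" "u2 \<in> \<Omega>" using u1 u2 by (auto simp: SOL_def)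
  define y where "y = u1 - \<rho> *\<^sub>R F1 u1"
  define p where "p = metric_projection (K u2) y"
  define e where "e = norm (p - u1)"
  define n where "n = norm (p - u2)"
  have u2K: "u2 \<in> K u2" using u2 by (simp add: SOL_def)
  have pK: "p \<in> K u2" unfolding p_def using K[OF in\<Omega>(2)] by (intro metric_projection_in) auto
  then have p\<Omega>: "p \<in> \<Omega>" using K[OF in\<Omega>(2)] by auto
  have e: "e \<le> l\<^sub>K * norm (u2 - u1)"
    using proj[OF in\<Omega>, of y] SOL_fixed_point_projection[OF u1, of \<rho>] \<rho>
    by (simp add: e_def p_def y_def)
  have "inner (y - p) (u2 - p) \<le> 0"
    unfolding p_def using K[OF in\<Omega>(2)] u2K by (intro metric_projection_inner_le) auto
  then have "\<rho> * inner (F1 u1) (p - u2) \<le> inner (u1 - p) (p - u2)"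
    by (simp add: y_def inner_diff_left inner_diff_right algebra_simps)
  also have "\<dots> \<le> e * n"
    using norm_cauchy_schwarz[of "u1 - p" "p - u2"] by (simp add: e_def n_def norm_minus_commute)
  finally have grad: "inner (F1 u1) (p - u2) \<le> \<eta> / 4 * e * n"
    using pos by (simp add: \<rho>_def field_simps)
  have "inner (F2 u2) (p - u2) \<ge> 0" using u2 pK by (simp add: SOL_def)
  then have "\<eta> * n\<^sup>2 \<le> inner (F2 p) (p - u2)"
    unfolding n_def using mono[OF in\<Omega>(2) pK u2K] by simp
  also have "\<dots> = inner (F2 p - F1 u1) (p - u2) + inner (F1 u1) (p - u2)"
    by (simp add: inner_diff_left)
  also have "inner (F2 p - F1 u1) (p - u2) \<le> norm (F2 p - F1 u1) * n"
    unfolding n_def by (rule norm_cauchy_schwarz)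
  also have "norm (F2 p - F1 u1) * n \<le> l\<^sub>G * (d + e) * n"
    using lip[OF in\<Omega>(1) p\<Omega>] by (intro mult_right_mono) (auto simp: e_def n_def)
  also note grad
  finally have "n * (\<eta> * n) \<le> n * (l\<^sub>G * (d + e) + \<eta> / 4 * e)"
    by (simp add: power2_eq_square algebra_simps)
  moreover have "0 \<le> l\<^sub>G * (d + e) + \<eta> / 4 * e"
    using lip[OF in\<Omega>(1) p\<Omega>] pos norm_ge_zero[of "F2 p - F1 u1"]
    unfolding e_def by (intro add_nonneg_nonneg) (linarith | simp)+
  moreover have "n \<ge> 0" by (simp add: n_def)
  ultimately have "\<eta> * n \<le> l\<^sub>G * (d + e) + \<eta> / 4 * e"
    by (cases "n = 0") (auto simp: mult_le_cancel_left)
  then have "n \<le> l\<^sub>G / \<eta> * d + (1/4 + l\<^sub>G / \<eta>) * e"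
    using pos by (simp add: field_simps)
  moreover have "norm (u2 - u1) \<le> e + n"
    using norm_triangle_ineq4[of "p - u1" "p - u2"] by (simp add: e_def n_def)
  ultimately have "norm (u2 - u1) \<le> l\<^sub>G / \<eta> * d + (5/4 + l\<^sub>G / \<eta>) * e"
    by (simp add: algebra_simps)
  also have "\<dots> \<le> l\<^sub>G / \<eta> * d + (5/4 + l\<^sub>G / \<eta>) * (l\<^sub>K * norm (u2 - u1))"
    using pos e by (intro add_left_mono mult_left_mono) auto
  finally show ?thesis by (simp add: algebra_simps)
qed

text \<open>With \<open>r = l\<^sub>G / \<eta>\<close> the hypothesis reads
  \<open>l\<^sub>K\<^sup>2 (2 r \<surd>(4 r\<^sup>2 + 2) + 4 r\<^sup>2 + 2) < 1\<close>, and the bracket exceeds \<open>(5/4 + r)\<^sup>2\<close> because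
  \<open>\<surd>(4 r\<^sup>2 + 2) \<ge> 5/4\<close>.\<close>

lemma projection_constant_small:
  fixes l\<^sub>G l\<^sub>K \<eta> :: real
  assumes "l\<^sub>G \<ge> 0" "\<eta> > 0" "l\<^sub>K \<ge> 0"
    and small: "2 * (l\<^sub>K\<^sup>2 / \<eta>\<^sup>2) * (l\<^sub>G * sqrt (4 * l\<^sub>G\<^sup>2 + 2 * \<eta>\<^sup>2) + 2 * l\<^sub>G\<^sup>2 + \<eta>\<^sup>2) < 1"
  shows "l\<^sub>K * (5/4 + l\<^sub>G / \<eta>) < 1"
proof -
  have "5/4 * \<eta> \<le> sqrt (4 * l\<^sub>G\<^sup>2 + 2 * \<eta>\<^sup>2)"
    by (rule real_le_rsqrt) (simp add: power_mult_distrib power2_eq_square)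
  then have "l\<^sub>G * (5/4 * \<eta>) \<le> l\<^sub>G * sqrt (4 * l\<^sub>G\<^sup>2 + 2 * \<eta>\<^sup>2)"
    using assms(1) by (rule mult_left_mono)
  moreover have "(5/4 * \<eta> + l\<^sub>G)\<^sup>2 = 25/16 * \<eta>\<^sup>2 + 2 * (l\<^sub>G * (5/4 * \<eta>)) + l\<^sub>G\<^sup>2"
    by (simp add: power2_eq_square algebra_simps)
  moreover have "a \<le> b \<Longrightarrow> x = 25/16 * e + 2 * a + m \<Longrightarrow> m \<ge> 0 \<Longrightarrow> e \<ge> 0 \<Longrightarrow>
    x \<le> 2 * (b + 2 * m + e)" for a b e m x :: real
    by simp
  ultimately have "(5/4 * \<eta> + l\<^sub>G)\<^sup>2 \<le> 2 * (l\<^sub>G * sqrt (4 * l\<^sub>G\<^sup>2 + 2 * \<eta>\<^sup>2) + 2 * l\<^sub>G\<^sup>2 + \<eta>\<^sup>2)"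
    by (metis zero_le_power2)
  then have "l\<^sub>K\<^sup>2 / \<eta>\<^sup>2 * (5/4 * \<eta> + l\<^sub>G)\<^sup>2
      \<le> l\<^sub>K\<^sup>2 / \<eta>\<^sup>2 * (2 * (l\<^sub>G * sqrt (4 * l\<^sub>G\<^sup>2 + 2 * \<eta>\<^sup>2) + 2 * l\<^sub>G\<^sup>2 + \<eta>\<^sup>2))"
    by (rule mult_left_mono) simp
  also have "\<dots> < 1" using small by (simp only: mult_ac)
  also have "l\<^sub>K\<^sup>2 / \<eta>\<^sup>2 * (5/4 * \<eta> + l\<^sub>G)\<^sup>2 = (l\<^sub>K * ((5/4 * \<eta> + l\<^sub>G) / \<eta>))\<^sup>2"
    by (simp only: power_mult_distrib power_divide times_divide_eq_left times_divide_eq_right)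
  also have "(5/4 * \<eta> + l\<^sub>G) / \<eta> = 5/4 + l\<^sub>G / \<eta>"
    using assms(2) by (simp add: add_divide_distrib)
  finally have "(l\<^sub>K * (5/4 + l\<^sub>G / \<eta>))\<^sup>2 < 1\<^sup>2" by simp
  then show ?thesis by (rule power_less_imp_less_base) simp
qed

section \<open>Norm estimates for Bochner and fractional integrals\<close>

text \<open>Without second countability the difference of two Borel functions need not be Borel; when one
  of them takes finitely many values, measurability can be checked on each level set.\<close>

lemma borel_measurable_norm_diff_simple:
  fixes F :: "'m \<Rightarrow> 'a::real_normed_vector"
  assumes F: "F \<in> borel_measurable M" and S: "simple_function M S"
  shows "(\<lambda>t. norm (F t - S t)) \<in> borel_measurable M"
proof (rule measurable_compose_countable'[where I = "S ` space M" and f = "\<lambda>y t. norm (F t - y)"])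
  fix y :: 'a
  have "(\<lambda>v. norm (v - y)) \<in> borel_measurable borel"
    by (intro borel_measurable_continuous_onI continuous_intros)
  then show "(\<lambda>t. norm (F t - y)) \<in> borel_measurable M"
    by (rule measurable_compose[OF F])
next
  show "S \<in> measurable M (count_space (S ` space M))"
    using S by (auto simp: measurable_count_space_eq2 simple_function_def)
  show "countable (S ` space M)" using S by (simp add: simple_function_def countable_finite)
qed

text \<open>The integrals of simple functions approximating \<open>F1\<close> and \<open>F2\<close> satisfy the estimate up to an
  error that tends to zero. A separate measurable majorant \<open>B\<close> stands in for \<open>\<parallel>F1 - F2\<parallel>\<close>, which
  may fail to be measurable.\<close>

lemma bochner_has_integral_norm_diff_le:
  fixes F1 F2 :: "'m \<Rightarrow> 'a::real_normed_vector"
  assumes F1: "bochner_has_integral M F1 J1" and F2: "bochner_has_integral M F2 J2"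
    and B[measurable]: "B \<in> borel_measurable M"
    and le: "\<And>t. t \<in> space M \<Longrightarrow> ennreal (norm (F1 t - F2 t)) \<le> B t"
  shows "ennreal (norm (J1 - J2)) \<le> (\<integral>\<^sup>+ t. B t \<partial>M)"
proof -
  from F1 obtain S1 where m1: "F1 \<in> borel_measurable M"
    and S1: "\<And>i. Bochner_Integration.simple_bochner_integrable M (S1 i)"
    and lim1: "(\<lambda>i::nat. \<integral>\<^sup>+ t. ennreal (norm (F1 t - S1 i t)) \<partial>M) \<longlonglongrightarrow> 0"
    and J1: "(\<lambda>i. Bochner_Integration.simple_bochner_integral M (S1 i)) \<longlonglongrightarrow> J1"
    unfolding bochner_has_integral_def by blast
  from F2 obtain S2 where m2: "F2 \<in> borel_measurable M"
    and S2: "\<And>i. Bochner_Integration.simple_bochner_integrable M (S2 i)"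
    and lim2: "(\<lambda>i::nat. \<integral>\<^sup>+ t. ennreal (norm (F2 t - S2 i t)) \<partial>M) \<longlonglongrightarrow> 0"
    and J2: "(\<lambda>i. Bochner_Integration.simple_bochner_integral M (S2 i)) \<longlonglongrightarrow> J2"
    unfolding bochner_has_integral_def by blast
  let ?I = "Bochner_Integration.simple_bochner_integral M"
  have [measurable]: "(\<lambda>t. norm (F1 t - S1 i t)) \<in> borel_measurable M"
      "(\<lambda>t. norm (F2 t - S2 i t)) \<in> borel_measurable M" for i
    using S1 S2 by (auto intro!: borel_measurable_norm_diff_simple m1 m2
        simp: Bochner_Integration.simple_bochner_integrable.simps)
  have simple_le: "ennreal (norm (?I (S1 i) - ?I (S2 i)))
      \<le> (\<integral>\<^sup>+ t. B t \<partial>M) + ((\<integral>\<^sup>+ t. ennreal (norm (F1 t - S1 i t)) \<partial>M)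
         + (\<integral>\<^sup>+ t. ennreal (norm (F2 t - S2 i t)) \<partial>M))" for i
  proof -
    have "ennreal (norm (?I (S1 i) - ?I (S2 i))) = ennreal (norm (?I (\<lambda>t. S1 i t - S2 i t)))"
      using S1 S2 by (subst Bochner_Integration.simple_bochner_integral_diff) auto
    also have "\<dots> \<le> ennreal (?I (\<lambda>t. norm (S1 i t - S2 i t)))"
      using Bochner_Integration.simple_bochner_integrable_compose2[of "(-)" M "S1 i" "S2 i"] S1 S2
      by (auto intro!: ennreal_leI Bochner_Integration.simple_bochner_integral_norm_bound)
    also have "\<dots> = (\<integral>\<^sup>+ t. ennreal (norm (S1 i t - S2 i t)) \<partial>M)"
      using Bochner_Integration.simple_bochner_integrable_compose2[of "\<lambda>x y. norm (x - y)" M "S1 i" "S2 i"]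
        S1 S2
      by (auto intro!: Bochner_Integration.simple_bochner_integral_eq_nn_integral)
    also have "\<dots> \<le> (\<integral>\<^sup>+ t. B t + (ennreal (norm (F1 t - S1 i t)) + ennreal (norm (F2 t - S2 i t))) \<partial>M)"
    proof (rule nn_integral_mono)
      fix t assume t: "t \<in> space M"
      have "S1 i t - S2 i t = (F1 t - F2 t) - (F1 t - S1 i t) + (F2 t - S2 i t)" by simp
      then have "norm (S1 i t - S2 i t)
          \<le> norm (F1 t - F2 t) + (norm (F1 t - S1 i t) + norm (F2 t - S2 i t))"
        by (smt (verit) norm_triangle_ineq norm_triangle_ineq4)
      then have "ennreal (norm (S1 i t - S2 i t))
          \<le> ennreal (norm (F1 t - F2 t)) + (ennreal (norm (F1 t - S1 i t)) + ennreal (norm (F2 t - S2 i t)))"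
        by (simp flip: ennreal_plus)
      also have "\<dots> \<le> B t + (ennreal (norm (F1 t - S1 i t)) + ennreal (norm (F2 t - S2 i t)))"
        using le[OF t] by (intro add_right_mono)
      finally show "ennreal (norm (S1 i t - S2 i t)) \<le> \<dots>" .
    qed
    also have "\<dots> = (\<integral>\<^sup>+ t. B t \<partial>M) + ((\<integral>\<^sup>+ t. ennreal (norm (F1 t - S1 i t)) \<partial>M)
         + (\<integral>\<^sup>+ t. ennreal (norm (F2 t - S2 i t)) \<partial>M))"
      by (simp add: nn_integral_add)
    finally show ?thesis .
  qed
  have "(\<lambda>i. ennreal (norm (?I (S1 i) - ?I (S2 i)))) \<longlonglongrightarrow> ennreal (norm (J1 - J2))"
    by (intro tendsto_intros J1 J2)
  moreover have "(\<lambda>i. (\<integral>\<^sup>+ t. B t \<partial>M) + ((\<integral>\<^sup>+ t. ennreal (norm (F1 t - S1 i t)) \<partial>M)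
      + (\<integral>\<^sup>+ t. ennreal (norm (F2 t - S2 i t)) \<partial>M))) \<longlonglongrightarrow> (\<integral>\<^sup>+ t. B t \<partial>M) + (0 + 0)"
    by (intro tendsto_add tendsto_const lim1 lim2)
  ultimately have "ennreal (norm (J1 - J2)) \<le> (\<integral>\<^sup>+ t. B t \<partial>M) + (0 + 0)"
    by (rule LIMSEQ_le) (use simple_le in auto)
  then show ?thesis by simp
qed

lemma bochner_has_integral_zero:
  "bochner_has_integral M (\<lambda>_. 0 :: 'a::real_normed_vector) 0"
proof -
  have "Bochner_Integration.simple_bochner_integrable M (\<lambda>_. 0 :: 'a)"
    by (simp add: Bochner_Integration.simple_bochner_integrable.simps)
  moreover have "Bochner_Integration.simple_bochner_integral M (\<lambda>_. 0 :: 'a) = 0"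
    unfolding Bochner_Integration.simple_bochner_integral_def by (intro sum.neutral) auto
  ultimately show ?thesis
    unfolding bochner_has_integral_def by (intro conjI exI[of _ "\<lambda>_ _. 0"]) simp_all
qed

lemma fractional_integral_at_zero:
  assumes "has_fractional_integral q F 0 J"
  shows "J = 0"
proof -
  obtain J0 where J0: "bochner_has_integral (lebesgue_on {0..0}) (\<lambda>\<zeta>. (0 - \<zeta>) powr (q - 1) *\<^sub>R F \<zeta>) J0"
    and J: "J = (1 / Gamma q) *\<^sub>R J0"
    using assms unfolding has_fractional_integral_def by blast
  have "ennreal (norm (J0 - 0)) \<le> (\<integral>\<^sup>+ t. 0 \<partial>lebesgue_on {0..0::real})"
    using J0 bochner_has_integral_zero by (rule bochner_has_integral_norm_diff_le) auto
  then show ?thesis using J by simp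
qed

text \<open>The substitution \<open>\<tau> = \<mu> (s - t)\<close> turns the integral over \<open>(-\<infinity>, s]\<close> into
  \<open>exp (\<mu> s) \<mu>\<^sup>-\<^sup>q\<close> times Euler's integral for \<open>Gamma q\<close>; restricting to \<open>[0, s]\<close> only decreases it.\<close>

lemma fractional_kernel_exp_le:
  assumes "q > 0" "\<mu> > 0"
  shows "(\<integral>\<^sup>+ t. ennreal ((s - t) powr (q - 1) * exp (\<mu> * t)) \<partial>lebesgue_on {0..s})
           \<le> ennreal (Gamma q * exp (\<mu> * s) / \<mu> powr q)"
proof -
  define f where "f t = indicator {0..} t * t powr (q - 1) / exp t" for t :: real
  have [measurable]: "f \<in> borel_measurable borel" unfolding f_def by measurable
  have f0: "f t \<ge> 0" for t by (simp add: f_def)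
  have "(\<integral>\<^sup>+ t. ennreal ((s - t) powr (q - 1) * exp (\<mu> * t)) \<partial>lebesgue_on {0..s})
      = (\<integral>\<^sup>+ t. ennreal ((s - t) powr (q - 1) * exp (\<mu> * t)) * indicator {0..s} t \<partial>lborel)"
    by (subst nn_integral_restrict_space) (auto simp: nn_integral_completion)
  also have "\<dots> \<le> (\<integral>\<^sup>+ t. ennreal (exp (\<mu> * s) / \<mu> powr (q - 1)) * ennreal (f (\<mu> * s + (- \<mu>) * t)) \<partial>lborel)"
  proof (rule nn_integral_mono)
    fix t
    show "ennreal ((s - t) powr (q - 1) * exp (\<mu> * t)) * indicator {0..s} t
        \<le> ennreal (exp (\<mu> * s) / \<mu> powr (q - 1)) * ennreal (f (\<mu> * s + (- \<mu>) * t))"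
    proof (cases "t \<in> {0..s}")
      case True
      have "f (\<mu> * s + (- \<mu>) * t) = f (\<mu> * (s - t))" by (simp add: algebra_simps)
      also have "\<dots> = \<mu> powr (q - 1) * (s - t) powr (q - 1) / exp (\<mu> * (s - t))"
        using True assms by (simp add: f_def powr_mult)
      finally have "(s - t) powr (q - 1) * exp (\<mu> * t)
          = exp (\<mu> * s) / \<mu> powr (q - 1) * f (\<mu> * s + (- \<mu>) * t)"
        using assms by (simp add: right_diff_distrib exp_diff)
      then show ?thesis using True f0 assms by (simp flip: ennreal_mult)
    qed auto
  qed
  also have "\<dots> = ennreal (exp (\<mu> * s) / \<mu> powr (q - 1)) * (\<integral>\<^sup>+ t. ennreal (f (\<mu> * s + (- \<mu>) * t)) \<partial>lborel)"
    by (rule nn_integral_cmult) measurable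
  also have "(\<integral>\<^sup>+ t. ennreal (f (\<mu> * s + (- \<mu>) * t)) \<partial>lborel) = ennreal (Gamma q / \<mu>)"
  proof -
    have "ennreal (Gamma q) = (\<integral>\<^sup>+ t. ennreal (f t) \<partial>lborel)"
      unfolding f_def by (rule Gamma_conv_nn_integral_real[OF assms(1)])
    also have "\<dots> = ennreal \<mu> * (\<integral>\<^sup>+ t. ennreal (f (\<mu> * s + (- \<mu>) * t)) \<partial>lborel)"
      using assms by (subst nn_integral_real_affine[where c = "- \<mu>" and t = "\<mu> * s"]) auto
    finally have "ennreal (1 / \<mu>) * ennreal (Gamma q)
        = ennreal (1 / \<mu>) * ennreal \<mu> * (\<integral>\<^sup>+ t. ennreal (f (\<mu> * s + (- \<mu>) * t)) \<partial>lborel)"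
      by (simp add: mult.assoc)
    moreover have "ennreal (1 / \<mu>) * ennreal \<mu> = 1"
      using assms by (simp flip: ennreal_mult)
    ultimately show ?thesis
      using assms by (simp flip: ennreal_mult)
  qed
  also have "ennreal (exp (\<mu> * s) / \<mu> powr (q - 1)) * ennreal (Gamma q / \<mu>)
      = ennreal (Gamma q * exp (\<mu> * s) / \<mu> powr q)"
    using assms by (simp add: powr_diff field_simps flip: ennreal_mult)
  finally show ?thesis .
qed

lemma fractional_integral_norm_diff_le:
  assumes q: "q > 0" and \<mu>: "\<mu> > 0" and C: "C \<ge> 0"
    and F1: "has_fractional_integral q F1 s J1" and F2: "has_fractional_integral q F2 s J2"
    and le: "\<And>\<zeta>. \<zeta> \<in> {0..s} \<Longrightarrow> norm (F1 \<zeta> - F2 \<zeta>) \<le> C * exp (\<mu> * \<zeta>)"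
  shows "norm (J1 - J2) \<le> C * exp (\<mu> * s) / \<mu> powr q"
proof -
  let ?M = "lebesgue_on {0..s}"
  obtain J1' where J1': "bochner_has_integral ?M (\<lambda>\<zeta>. (s - \<zeta>) powr (q - 1) *\<^sub>R F1 \<zeta>) J1'"
    and J1: "J1 = (1 / Gamma q) *\<^sub>R J1'"
    using F1 unfolding has_fractional_integral_def by blast
  obtain J2' where J2': "bochner_has_integral ?M (\<lambda>\<zeta>. (s - \<zeta>) powr (q - 1) *\<^sub>R F2 \<zeta>) J2'"
    and J2: "J2 = (1 / Gamma q) *\<^sub>R J2'"
    using F2 unfolding has_fractional_integral_def by blast
  have G: "Gamma q > 0" using q by (rule Gamma_real_pos)
  have meas: "(\<lambda>t. ennreal ((s - t) powr (q - 1) * exp (\<mu> * t))) \<in> borel_measurable ?M"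
    by (intro measurable_restrict_space1 measurable_completion) measurable
  have "ennreal (norm (J1' - J2'))
      \<le> (\<integral>\<^sup>+ t. ennreal C * ennreal ((s - t) powr (q - 1) * exp (\<mu> * t)) \<partial>?M)"
  proof (rule bochner_has_integral_norm_diff_le[OF J1' J2'])
    show "(\<lambda>t. ennreal C * ennreal ((s - t) powr (q - 1) * exp (\<mu> * t))) \<in> borel_measurable ?M"
      using meas by measurable
    fix t assume "t \<in> space ?M"
    then have "t \<in> {0..s}" by simp
    from le[OF this] have "(s - t) powr (q - 1) * norm (F1 t - F2 t) \<le> (s - t) powr (q - 1) * (C * exp (\<mu> * t))"
      by (intro mult_left_mono) auto
    then show "ennreal (norm ((s - t) powr (q - 1) *\<^sub>R F1 t - (s - t) powr (q - 1) *\<^sub>R F2 t))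
        \<le> ennreal C * ennreal ((s - t) powr (q - 1) * exp (\<mu> * t))"
      using C by (simp add: mult_ac flip: ennreal_mult scaleR_diff_right)
  qed
  also have "\<dots> = ennreal C * (\<integral>\<^sup>+ t. ennreal ((s - t) powr (q - 1) * exp (\<mu> * t)) \<partial>?M)"
    using meas by (rule nn_integral_cmult)
  also have "\<dots> \<le> ennreal C * ennreal (Gamma q * exp (\<mu> * s) / \<mu> powr q)"
    using fractional_kernel_exp_le[OF q \<mu>] by (intro mult_left_mono) auto
  also have "\<dots> = ennreal (C * (Gamma q * exp (\<mu> * s) / \<mu> powr q))"
    using C G by (simp flip: ennreal_mult)
  finally have "norm (J1' - J2') \<le> C * (Gamma q * exp (\<mu> * s) / \<mu> powr q)"
    using C G by (subst (asm) ennreal_le_iff) auto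
  moreover have "norm (J1 - J2) = norm (J1' - J2') / Gamma q"
    using G by (simp add: J1 J2 flip: scaleR_diff_right)
  ultimately show ?thesis using G by (simp add: divide_le_eq mult_ac)
qed

section \<open>A fractional Gronwall inequality\<close>

text \<open>The hypothesis says that \<open>w\<close> is dominated by the fractional integral of \<open>M w + \<phi>\<close>, tested only
  against exponential majorants; this form avoids integrating \<open>w\<close> itself. With the weight
  \<open>exp (- \<mu> t)\<close> and \<open>\<mu>\<^sup>q = 2 M\<close> the operator \<open>w \<mapsto> I\<^sup>q (M w)\<close> has norm at most \<open>1/2\<close>, so the
  weighted maximum \<open>W\<close> of \<open>w\<close> over \<open>[0, s]\<close> can be absorbed.\<close>

lemma fractional_gronwall:
  fixes w \<phi> :: "real \<Rightarrow> real"
  assumes M: "M > 0" and \<mu>: "\<mu> > 0" "\<mu> powr q = 2 * M"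
    and w: "continuous_on {0..T} w" and w0: "\<And>t. t \<in> {0..T} \<Longrightarrow> w t \<ge> 0"
    and \<phi>0: "\<And>t. t \<in> {0..T} \<Longrightarrow> \<phi> t \<ge> 0" and mono: "mono_on {0..T} \<phi>"
    and int: "\<And>t C. t \<in> {0..T} \<Longrightarrow> C \<ge> 0 \<Longrightarrow>
                (\<And>\<zeta>. \<zeta> \<in> {0..t} \<Longrightarrow> M * w \<zeta> + \<phi> \<zeta> \<le> C * exp (\<mu> * \<zeta>)) \<Longrightarrow>
                w t \<le> C * exp (\<mu> * t) / \<mu> powr q"
    and s: "s \<in> {0..T}"
  shows "w s \<le> exp (\<mu> * s) / M * \<phi> s"
proof -
  have "continuous_on {0..s} (\<lambda>t. exp (- \<mu> * t) * w t)"
    using s by (intro continuous_intros continuous_on_subset[OF w]) auto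
  then obtain m where m: "m \<in> {0..s}"
    and max: "\<And>t. t \<in> {0..s} \<Longrightarrow> exp (- \<mu> * t) * w t \<le> exp (- \<mu> * m) * w m"
    using continuous_attains_sup[of "{0..s}" "\<lambda>t. exp (- \<mu> * t) * w t"] s by auto
  define W where "W = exp (- \<mu> * m) * w m"
  have W: "w t \<le> W * exp (\<mu> * t)" if "t \<in> {0..s}" for t
    using max[OF that] unfolding W_def by (simp add: exp_minus field_simps)
  have W0: "W \<ge> 0" using w0[of m] m s by (simp add: W_def)
  have "w m \<le> (M * W + \<phi> s) * exp (\<mu> * m) / \<mu> powr q"
  proof (rule int)
    show "m \<in> {0..T}" using m s by auto
    show "0 \<le> M * W + \<phi> s" using M W0 \<phi>0[OF s] by simp
    fix \<zeta> assume \<zeta>: "\<zeta> \<in> {0..m}"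
    have "M * w \<zeta> \<le> M * (W * exp (\<mu> * \<zeta>))"
      using M W[of \<zeta>] \<zeta> m by (intro mult_left_mono) auto
    moreover have "\<phi> \<zeta> \<le> \<phi> s" using \<zeta> m s by (intro mono_onD[OF mono]) auto
    moreover have "\<phi> s * 1 \<le> \<phi> s * exp (\<mu> * \<zeta>)"
      using \<phi>0[OF s] \<zeta> \<mu> by (intro mult_left_mono) auto
    ultimately show "M * w \<zeta> + \<phi> \<zeta> \<le> (M * W + \<phi> s) * exp (\<mu> * \<zeta>)"
      by (simp add: algebra_simps)
  qed
  then have "exp (- \<mu> * m) * w m \<le> exp (- \<mu> * m) * ((M * W + \<phi> s) * exp (\<mu> * m) / \<mu> powr q)"
    by (rule mult_left_mono) simp
  also have "\<dots> = (M * W + \<phi> s) / (2 * M)" by (simp add: \<mu>(2) exp_minus)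
  finally have "W \<le> (M * W + \<phi> s) / (2 * M)" by (simp only: W_def)
  then have "W \<le> \<phi> s / M" using M by (simp add: field_simps)
  then have "W * exp (\<mu> * s) \<le> \<phi> s / M * exp (\<mu> * s)" by (rule mult_right_mono) simp
  moreover have "w s \<le> W * exp (\<mu> * s)" using s by (intro W) auto
  ultimately show ?thesis by (simp add: mult_ac)
qed

section \<open>The Mittag-Leffler function on the positive half-line\<close>

text \<open>Restrict Euler's integral of \<open>t\<^sup>x exp (- t)\<close> to the unit interval \<open>[A, A + 1]\<close>.\<close>

lemma Gamma_ge_powr:
  fixes A x :: real
  assumes "A > 0" "x \<ge> 0"
  shows "A powr x * exp (- (A + 1)) \<le> Gamma (x + 1)"
proof -
  have "ennreal (A powr x * exp (- (A + 1)))
      = (\<integral>\<^sup>+ t. ennreal (A powr x * exp (- (A + 1))) * indicator {A..A+1} t \<partial>lborel)"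
    by (subst nn_integral_cmult_indicator) auto
  also have "\<dots> \<le> (\<integral>\<^sup>+ t. ennreal (indicator {0..} t * t powr (x + 1 - 1) / exp t) \<partial>lborel)"
  proof (rule nn_integral_mono)
    fix t
    show "ennreal (A powr x * exp (- (A + 1))) * indicator {A..A+1} t
        \<le> ennreal (indicator {0..} t * t powr (x + 1 - 1) / exp t)"
    proof (cases "t \<in> {A..A+1}")
      case True
      then have "A powr x * exp (- (A + 1)) \<le> t powr x * exp (- t)"
        using assms by (intro mult_mono powr_mono2) auto
      then show ?thesis using True assms
        by (simp add: ennreal_leI exp_minus divide_inverse)
    qed auto
  qed
  also have "\<dots> = ennreal (Gamma (x + 1))"
    using assms by (intro Gamma_conv_nn_integral_real[symmetric]) auto
  finally show ?thesis
    using assms by (subst (asm) ennreal_le_iff) (auto intro!: less_imp_le Gamma_real_pos)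
qed

lemma mittag_leffler_summable:
  assumes "q > 0" "t \<ge> 0"
  shows "summable (\<lambda>n. t ^ n / Gamma (real n * q + 1))"
proof -
  \<comment> \<open>With \<open>A\<^sup>q = 2 t + 1\<close> in the lower bound for \<open>Gamma\<close>, the terms are dominated by a
    geometric series of ratio below \<open>1/2\<close>.\<close>
  define A where "A = (2 * t + 1) powr (1 / q)"
  have A: "A > 0" using assms by (simp add: A_def)
  have Aq: "A powr q = 2 * t + 1" using assms by (simp add: A_def powr_powr)
  have bound: "norm (t ^ n / Gamma (real n * q + 1)) \<le> exp (A + 1) * (t / (2 * t + 1)) ^ n" for n
  proof -
    have "A powr (real n * q) = (A powr q) powr real n" by (simp add: powr_powr mult.commute)
    also have "\<dots> = (2 * t + 1) ^ n" using assms by (simp add: Aq powr_realpow)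
    finally have "(2 * t + 1) ^ n * exp (- (A + 1)) \<le> Gamma (real n * q + 1)"
      using Gamma_ge_powr[OF A, of "real n * q"] assms by simp
    moreover have "(2 * t + 1) ^ n * exp (- (A + 1)) > 0" using assms by simp
    moreover have G: "Gamma (real n * q + 1) > 0"
      using assms by (intro Gamma_real_pos add_nonneg_pos) auto
    ultimately have "t ^ n / Gamma (real n * q + 1) \<le> t ^ n / ((2 * t + 1) ^ n * exp (- (A + 1)))"
      using assms by (intro divide_left_mono) (auto intro!: mult_pos_pos)
    also have "\<dots> = exp (A + 1) * (t / (2 * t + 1)) ^ n"
      by (simp only: exp_minus power_divide) (simp add: field_simps)
    finally show ?thesis
      using assms G by simp
  qed
  have "summable (\<lambda>n. exp (A + 1) * (t / (2 * t + 1)) ^ n)"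
    using assms by (intro summable_mult summable_geometric) auto
  then show ?thesis using bound by (rule summable_comparison_test'[rotated 0, where N = 0])
qed

lemma mittag_leffler_ge_1:
  assumes "q > 0" "t \<ge> 0"
  shows "mittag_leffler q t \<ge> 1"
proof -
  have "(\<Sum>n<1. t ^ n / Gamma (real n * q + 1)) \<le> (\<Sum>n. t ^ n / Gamma (real n * q + 1))"
    using assms by (intro sum_le_suminf mittag_leffler_summable)
      (auto intro!: divide_nonneg_pos Gamma_real_pos add_nonneg_pos)
  then show ?thesis by (simp add: mittag_leffler_def)
qed

section \<open>Stability\<close>

theorem theorem4p2:
  fixes T q \<gamma> l\<^sub>G \<eta>\<^sub>G l\<^sub>K l\<^sub>g l\<^sub>f l\<^sub>\<psi> :: real
    and \<Omega> :: "'b::{real_inner, complete_space} set"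
    and K :: "'b \<Rightarrow> 'b set"
    and f :: "real \<Rightarrow> 'a::{real_inner, complete_space} \<Rightarrow> 'a"
    and g :: "real \<Rightarrow> 'a \<Rightarrow> 'b \<Rightarrow> 'a"
    and G :: "real \<Rightarrow> 'a \<Rightarrow> 'b \<Rightarrow> 'b"
    and \<psi> :: "(real \<Rightarrow> 'a) \<Rightarrow> 'a"
    and x0 :: 'a
    and \<phi> :: "real \<Rightarrow> real"
  assumes "T > 0" and "0 < q" and "q \<le> 1" and "\<gamma> > 0"
    and "\<Omega> \<noteq> {}" and "closed \<Omega>" and "convex \<Omega>"
    and "\<And>u. u \<in> \<Omega> \<Longrightarrow> K u \<subseteq> \<Omega> \<and> K u \<noteq> {} \<and> closed (K u) \<and> convex (K u)"
    and "l\<^sub>G > 0" and "\<eta>\<^sub>G > 0"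
    and "\<And>s1 s2 x1 x2 u1 u2. s1 \<in> {0..T} \<Longrightarrow> s2 \<in> {0..T} \<Longrightarrow> u1 \<in> \<Omega> \<Longrightarrow> u2 \<in> \<Omega> \<Longrightarrow>
           norm (G s2 x2 u2 - G s1 x1 u1)
             \<le> l\<^sub>G * (\<bar>s2 - s1\<bar> + norm (x2 - x1) + norm (u2 - u1))"
    and "\<And>s x u u1 u2. s \<in> {0..T} \<Longrightarrow> u \<in> \<Omega> \<Longrightarrow> u1 \<in> K u \<Longrightarrow> u2 \<in> K u \<Longrightarrow>
           inner (G s x u2) (u1 - u2) \<ge> 0 \<Longrightarrow>
           inner (G s x u1) (u1 - u2) \<ge> \<eta>\<^sub>G * (norm (u1 - u2))\<^sup>2"
    and "l\<^sub>K \<ge> 0"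
    and "\<And>u1 u2 w. u1 \<in> \<Omega> \<Longrightarrow> u2 \<in> \<Omega> \<Longrightarrow>
           norm (metric_projection (K u2) w - metric_projection (K u1) w) \<le> l\<^sub>K * norm (u2 - u1)"
    and "continuous_on ({0..T} \<times> UNIV \<times> UNIV) (\<lambda>(s, x, u). g s x u)"
    and "l\<^sub>g > 0"
    and "\<And>s x1 x2 u1 u2. s \<in> {0..T} \<Longrightarrow>
           norm (g s x2 u2 - g s x1 u1) \<le> l\<^sub>g * (norm (x2 - x1) + norm (u2 - u1))"
    and "continuous_on ({0..T} \<times> UNIV) (\<lambda>(s, x). f s x)"
    and "l\<^sub>f > 0"
    and "\<And>s x1 x2. s \<in> {0..T} \<Longrightarrow> norm (f s x2 - f s x1) \<le> l\<^sub>f * norm (x2 - x1)"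
    and "bielecki_continuous \<gamma> T \<psi>"
    and "0 < l\<^sub>\<psi>" and "l\<^sub>\<psi> < 1"
    and "\<And>y1 y2. continuous_on {0..T} y1 \<Longrightarrow> continuous_on {0..T} y2 \<Longrightarrow>
           norm (\<psi> y2 - \<psi> y1) \<le> l\<^sub>\<psi> * bielecki_norm \<gamma> T (\<lambda>s. y2 s - y1 s)"
    and "2 * (l\<^sub>K\<^sup>2 / \<eta>\<^sub>G\<^sup>2) * (l\<^sub>G * sqrt (4 * l\<^sub>G\<^sup>2 + 2 * \<eta>\<^sub>G\<^sup>2) + 2 * l\<^sub>G\<^sup>2 + \<eta>\<^sub>G\<^sup>2) < 1"
    and "continuous_on {0..T} \<phi>"
    and "\<And>s. s \<in> {0..T} \<Longrightarrow> \<phi> s \<ge> 0"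
    and "mono_on {0..T} \<phi>"
  shows "generalized_ML_HUR_stable T q \<Omega> K f g G \<psi> x0 \<phi>"
proof -
  define \<kappa> where "\<kappa> = 1 - l\<^sub>K * (5/4 + l\<^sub>G / \<eta>\<^sub>G)"
  have \<kappa>: "\<kappa> > 0"
    using projection_constant_small[of l\<^sub>G \<eta>\<^sub>G l\<^sub>K] assms(9,10,13,25) by (simp add: \<kappa>_def)
  define L where "L = l\<^sub>G / \<eta>\<^sub>G / \<kappa>"
  have L: "L > 0" using \<kappa> \<open>l\<^sub>G > 0\<close> \<open>\<eta>\<^sub>G > 0\<close> by (simp add: L_def)
  have SOL_lip: "norm (\<upsilon> - u) \<le> L * norm (z - x)"
    if "s \<in> {0..T}" "u \<in> SOL \<Omega> K (G s x)" "\<upsilon> \<in> SOL \<Omega> K (G s z)" for s x z u \<upsilon>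
  proof -
    have "\<kappa> * norm (\<upsilon> - u) \<le> l\<^sub>G / \<eta>\<^sub>G * norm (z - x)"
      unfolding \<kappa>_def
    proof (rule SOL_lipschitz[where ?F1.0 = "G s x" and ?F2.0 = "G s z"])
      show "norm (G s z w - G s x v) \<le> l\<^sub>G * (norm (z - x) + norm (w - v))"
        if "v \<in> \<Omega>" "w \<in> \<Omega>" for v w
        using assms(11)[OF \<open>s \<in> {0..T}\<close> \<open>s \<in> {0..T}\<close> that] by simp
    qed (use that assms(8-10,12,14) in auto)
    then have "norm (\<upsilon> - u) \<le> l\<^sub>G / \<eta>\<^sub>G * norm (z - x) / \<kappa>"
      using \<kappa> by (simp only: pos_le_divide_eq mult.commute)
    then show ?thesis by (simp add: L_def)
  qed
  \<comment> \<open>Lipschitz constant of the right-hand side along solutions: \<open>u\<close> contributes through the state.\<close>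
  define M where "M = l\<^sub>f + l\<^sub>g * (1 + L)"
  have M: "M > 0" using L \<open>l\<^sub>f > 0\<close> \<open>l\<^sub>g > 0\<close> by (simp add: M_def add_pos_pos)
  define \<mu> where "\<mu> = (2 * M) powr (1 / q)"
  have \<mu>: "\<mu> > 0" "\<mu> powr q = 2 * M" using M \<open>0 < q\<close> by (auto simp: \<mu>_def powr_powr)
  define c where "c = exp (\<mu> * T) / M"
  have c: "c > 0" using M by (simp add: c_def)
  have estimate: "norm (z s - x s) \<le> c * \<phi> s * mittag_leffler q s"
    if sol: "nfdqvi_solution T q \<Omega> K f g G \<psi> x0 x u"
      and pert: "perturbed_solution T q \<Omega> K f g G \<phi> x z \<upsilon>"
      and s: "s \<in> {0..T}" for x u z \<upsilon> s
  proof -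
    have x: "continuous_on {0..T} x" and z: "continuous_on {0..T} z" and z0: "z 0 = x 0"
      using sol pert by (auto simp: nfdqvi_solution_def perturbed_solution_def)
    have u: "\<And>t. t \<in> {0..T} \<Longrightarrow> u t \<in> SOL \<Omega> K (G t (x t))"
      and \<upsilon>: "\<And>t. t \<in> {0..T} \<Longrightarrow> \<upsilon> t \<in> SOL \<Omega> K (G t (z t))"
      using sol pert by (auto simp: nfdqvi_solution_def perturbed_solution_def)
    have xJ: "\<And>t. t \<in> {0..T} \<Longrightarrow> \<exists>J. has_fractional_integral q (\<lambda>\<zeta>. f \<zeta> (x \<zeta>) + g \<zeta> (x \<zeta>) (u \<zeta>)) t J \<and>
             x t = x0 + \<psi> x + J"
      using sol by (simp add: nfdqvi_solution_def)
    obtain h where h: "\<And>t. t \<in> {0..T} \<Longrightarrow> norm (h t) \<le> \<phi> t"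
      and zJ: "\<And>t. t \<in> {0..T} \<Longrightarrow> \<exists>J. has_fractional_integral q
             (\<lambda>\<zeta>. f \<zeta> (z \<zeta>) + g \<zeta> (z \<zeta>) (\<upsilon> \<zeta>) + h \<zeta>) t J \<and> z t = z 0 + J"
      using pert unfolding perturbed_solution_def by blast
    have "0 \<in> {0..T}" using \<open>T > 0\<close> by simp
    from xJ[OF this] have x_init: "x 0 = x0 + \<psi> x"
      by (auto dest: fractional_integral_at_zero)
    have rhs: "norm (f \<zeta> (z \<zeta>) + g \<zeta> (z \<zeta>) (\<upsilon> \<zeta>) + h \<zeta> - (f \<zeta> (x \<zeta>) + g \<zeta> (x \<zeta>) (u \<zeta>)))
        \<le> M * norm (z \<zeta> - x \<zeta>) + \<phi> \<zeta>" if \<zeta>: "\<zeta> \<in> {0..T}" for \<zeta>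
    proof -
      let ?f = "f \<zeta> (z \<zeta>) - f \<zeta> (x \<zeta>)" and ?g = "g \<zeta> (z \<zeta>) (\<upsilon> \<zeta>) - g \<zeta> (x \<zeta>) (u \<zeta>)"
      have "norm (\<upsilon> \<zeta> - u \<zeta>) \<le> L * norm (z \<zeta> - x \<zeta>)"
        using SOL_lip[OF \<zeta> u[OF \<zeta>] \<upsilon>[OF \<zeta>]] .
      then have "l\<^sub>g * (norm (z \<zeta> - x \<zeta>) + norm (\<upsilon> \<zeta> - u \<zeta>))
          \<le> l\<^sub>g * (norm (z \<zeta> - x \<zeta>) + L * norm (z \<zeta> - x \<zeta>))"
        using \<open>l\<^sub>g > 0\<close> by (intro mult_left_mono) auto
      then have "norm ?g \<le> l\<^sub>g * (norm (z \<zeta> - x \<zeta>) + L * norm (z \<zeta> - x \<zeta>))"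
        by (rule order_trans[OF assms(17)[OF \<zeta>]])
      moreover have "norm ?f \<le> l\<^sub>f * norm (z \<zeta> - x \<zeta>)" using assms(20)[OF \<zeta>] .
      moreover have "norm (?f + ?g + h \<zeta>) \<le> norm ?f + norm ?g + norm (h \<zeta>)"
        using norm_triangle_ineq[of "?f + ?g" "h \<zeta>"] norm_triangle_ineq[of ?f ?g] by linarith
      moreover note h[OF \<zeta>]
      ultimately have "norm (?f + ?g + h \<zeta>) \<le> M * norm (z \<zeta> - x \<zeta>) + \<phi> \<zeta>"
        by (simp add: M_def algebra_simps)
      then show ?thesis by (simp add: algebra_simps)
    qed
    have "norm (z s - x s) \<le> exp (\<mu> * s) / M * \<phi> s"
    proof (rule fractional_gronwall[OF M \<mu>, where T = T and w = "\<lambda>t. norm (z t - x t)"])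
      show "continuous_on {0..T} (\<lambda>t. norm (z t - x t))"
        by (intro continuous_intros x z)
      fix t C assume t: "t \<in> {0..T}" and C: "(C :: real) \<ge> 0"
        and bound: "\<And>\<zeta>. \<zeta> \<in> {0..t} \<Longrightarrow> M * norm (z \<zeta> - x \<zeta>) + \<phi> \<zeta> \<le> C * exp (\<mu> * \<zeta>)"
      obtain J1 where J1: "has_fractional_integral q (\<lambda>\<zeta>. f \<zeta> (x \<zeta>) + g \<zeta> (x \<zeta>) (u \<zeta>)) t J1"
        "x t = x0 + \<psi> x + J1"
        using xJ[OF t] by blast
      obtain J2 where J2: "has_fractional_integral q (\<lambda>\<zeta>. f \<zeta> (z \<zeta>) + g \<zeta> (z \<zeta>) (\<upsilon> \<zeta>) + h \<zeta>) t J2"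
        "z t = z 0 + J2"
        using zJ[OF t] by blast
      have "norm (J2 - J1) \<le> C * exp (\<mu> * t) / \<mu> powr q"
      proof (rule fractional_integral_norm_diff_le[OF \<open>0 < q\<close> \<mu>(1) C J2(1) J1(1)])
        fix \<zeta> assume \<zeta>: "\<zeta> \<in> {0..t}"
        then have "\<zeta> \<in> {0..T}" using t by auto
        from rhs[OF this] bound[OF \<zeta>]
        show "norm (f \<zeta> (z \<zeta>) + g \<zeta> (z \<zeta>) (\<upsilon> \<zeta>) + h \<zeta> - (f \<zeta> (x \<zeta>) + g \<zeta> (x \<zeta>) (u \<zeta>)))
            \<le> C * exp (\<mu> * \<zeta>)"
          by (rule order_trans)
      qed
      then show "norm (z t - x t) \<le> C * exp (\<mu> * t) / \<mu> powr q"
        using J1(2) J2(2) x_init z0 by simp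
    qed (use assms(27,28) s in auto)
    also have "\<dots> \<le> c * \<phi> s"
      unfolding c_def using s \<mu> M assms(27)[OF s] by (intro mult_right_mono divide_right_mono) auto
    also have "\<dots> = c * \<phi> s * 1" by simp
    also have "\<dots> \<le> c * \<phi> s * mittag_leffler q s"
      using mittag_leffler_ge_1[of q s] s c assms(27)[OF s] \<open>0 < q\<close> by (intro mult_left_mono) auto
    finally show ?thesis .
  qed
  show ?thesis
    unfolding generalized_ML_HUR_stable_def
  proof (intro exI[of _ c] conjI c allI impI, elim exE conjE)
    fix z \<upsilon> x u
    assume "nfdqvi_solution T q \<Omega> K f g G \<psi> x0 x u"
      "perturbed_solution T q \<Omega> K f g G \<phi> x z \<upsilon>"
    then show "\<exists>x u. nfdqvi_solution T q \<Omega> K f g G \<psi> x0 x u \<and>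
        perturbed_solution T q \<Omega> K f g G \<phi> x z \<upsilon> \<and>
        (\<forall>s\<in>{0..T}. norm (z s - x s) \<le> c * \<phi> s * mittag_leffler q s)"
      by (intro exI[of _ x] exI[of _ u] conjI ballI estimate)
  qed
qed

end
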